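(* Let $\Gamma$ be a simple graph on $V=\{1,\dots,n\}$ with edge ideal $I\subseteq R=k[x_1,\dots,x_n]$, let $t\ge 1$ be an integer and $\mathbf a\in\mathbb N^n$. If $x^{\mathbf a}\in\widetilde{I^t}\setminus I^t$, then $\deg x^{\mathbf a}\le 3(t-1)$.
   Context: $k$ is a field, $n\ge 1$, $\mathfrak m=(x_1,\dots,x_n)$. The edge ideal of $\Gamma$ is the ideal generated by the $x_ix_j$ with $\{i,j\}$ an edge of $\Gamma$. $x^{\mathbf a}=x_1^{a_1}\cdots x_n^{a_n}$, and $\deg x^{\mathbf a}=a_1+\cdots+a_n$. The saturation of an ideal $J$ of $R$ is $\widetilde J=\bigcup_{m\ge 1}(J:\mathfrak m^m)$. *)

theory Defs
  imports
    "HOL-Library.Poly_Mapping"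
    "HOL-Algebra.Ideal_Product"
    "HOL-Algebra.Algebraic_Closure_Type"
begin

text \<open>
  Polynomials over \<open>'k\<close> with one variable for each element of \<open>'n\<close>: finitely supported
  coefficient functions on exponent vectors, multiplied by convolution.  For a finite type \<open>'n\<close>
  with \<open>n\<close> elements this is \<open>k[x\<^sub>1, \<dots>, x\<^sub>n]\<close>.
\<close>

type_synonym ('n, 'k) mpoly = "('n \<Rightarrow>\<^sub>0 nat) \<Rightarrow>\<^sub>0 'k"

abbreviation mpoly_ring :: "('n, 'k::field) mpoly ring" where
  "mpoly_ring \<equiv> ring_of_type_algebra"

definition Var :: "'n \<Rightarrow> ('n, 'k::field) mpoly" where
  "Var i = Poly_Mapping.single (Poly_Mapping.single i 1) 1"

definition monomial :: "('n::finite \<Rightarrow> nat) \<Rightarrow> ('n, 'k::field) mpoly" where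
  "monomial a = (\<Prod>i\<in>UNIV. Var i ^ a i)"

definition irrelevant_ideal :: "('n, 'k::field) mpoly set" where
  "irrelevant_ideal = Idl\<^bsub>mpoly_ring\<^esub> (range Var)"

text \<open>
  Ideal powers are those of the multiplicative monoid of \<^const>\<open>ideals_set\<close>, i.e.\ iterated
  \<^const>\<open>ideal_prod\<close>, the zeroth power being the whole ring.
\<close>

abbreviation ideal_power :: "('a, 'b) ring_scheme \<Rightarrow> 'a set \<Rightarrow> nat \<Rightarrow> 'a set" where
  "ideal_power R I m \<equiv> I [^]\<^bsub>ideals_set R\<^esub> m"

definition ideal_colon :: "('a, 'b) ring_scheme \<Rightarrow> 'a set \<Rightarrow> 'a set \<Rightarrow> 'a set" where
  "ideal_colon R J K = {f \<in> carrier R. \<forall>g\<in>K. f \<otimes>\<^bsub>R\<^esub> g \<in> J}"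

definition saturation :: "('n, 'k::field) mpoly set \<Rightarrow> ('n, 'k) mpoly set" where
  "saturation J =
     (\<Union>m\<in>{1..}. ideal_colon mpoly_ring J (ideal_power mpoly_ring irrelevant_ideal m))"

text \<open>A simple graph is given by its vertex set and its edges, as two-element sets of vertices.\<close>

definition simple_graph :: "'v set \<Rightarrow> 'v set set \<Rightarrow> bool" where
  "simple_graph V E \<longleftrightarrow> finite V \<and> (\<forall>e\<in>E. e \<subseteq> V \<and> card e = 2)"

definition edge_ideal :: "'n set set \<Rightarrow> ('n, 'k::field) mpoly set" where
  "edge_ideal E = Idl\<^bsub>mpoly_ring\<^esub> {Var i * Var j | i j. {i, j} \<in> E}"

end

theory Submission
  imports Defs
begin

text \<open>
  A monomial \<open>x\<^sup>a\<close> lies in \<open>I\<^sup>t\<close> iff some multiset of \<open>t\<close> edges has all its vertex degrees bounded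
  by \<open>a\<close>, and \<open>x\<^sup>a\<close> in the saturation means that this becomes true after raising any single
  coordinate of \<open>a\<close> sufficiently.  Replacing vertex \<open>i\<close> by \<open>a\<^sub>i\<close> copies, take a largest packing
  \<open>M\<close>, and let \<open>U\<close> be the set of copies it leaves uncovered.  Alternating trails show that degree
  vectors of edge multisets form a jump system; with the maximality of \<open>M\<close> this turns each single
  augmentation at \<open>u \<in> U\<close> into an edge multiset of degree \<open>deg M + 2 u\<close>, and then all of them
  together into one with \<open>|M| + |U|\<close> edges and degree \<open>deg M + 2 U\<close>.  By maximality no edge lies
  inside \<open>U\<close>, so these edges meet \<open>U\<close> at most once each while \<open>U\<close> has total degree at least
  \<open>2|U|\<close>.  Hence \<open>|U| \<le> |M|\<close> and \<open>|a| = 2|M| + |U| \<le> 3|M| \<le> 3(t - 1)\<close>.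
\<close>

section \<open>Degree vectors of edge multisets\<close>

text \<open>Edges form a multiset because a product of edge monomials may repeat a factor; for
  two-element edges \<open>vdeg M\<close> is the exponent vector of that product.\<close>

definition vdeg :: "'v set multiset \<Rightarrow> 'v \<Rightarrow> nat" where
  "vdeg M v = size {#e \<in># M. v \<in> e#}"

lemma vdeg_empty [simp]: "vdeg {#} v = 0"
  by (simp add: vdeg_def)

lemma vdeg_add_mset [simp]: "vdeg (add_mset e M) v = of_bool (v \<in> e) + vdeg M v"
  by (simp add: vdeg_def)

lemma vdeg_union [simp]: "vdeg (M + N) v = vdeg M v + vdeg N v"
  by (simp add: vdeg_def)

lemma vdeg_diff: "N \<subseteq># M \<Longrightarrow> vdeg (M - N) v + vdeg N v = vdeg M v"
  by (metis subset_mset.diff_add vdeg_union)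

lemma vdeg_eq_0_iff: "vdeg M v = 0 \<longleftrightarrow> (\<forall>e\<in>#M. v \<notin> e)"
  by (induction M) auto

lemma sum_vdeg:
  assumes "finite W"
  shows "(\<Sum>v\<in>W. vdeg M v) = (\<Sum>e\<in>#M. card (e \<inter> W))"
proof (induction M)
  case (add e M)
  have "(\<Sum>v\<in>W. of_bool (v \<in> e)) = card (e \<inter> W)"
    using assms by (simp add: of_bool_def sum.If_cases Int_commute)
  with add show ?case
    by (simp add: sum.distrib)
qed simp

lemma handshake:
  assumes "finite W" and "\<And>e. e \<in># M \<Longrightarrow> e \<subseteq> W \<and> card e = 2"
  shows "(\<Sum>v\<in>W. vdeg M v) = 2 * size M"
proof -
  have "(\<Sum>e\<in>#M. card (e \<inter> W)) = (\<Sum>e\<in>#M. 2)"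
    by (intro arg_cong[of _ _ sum_mset] image_mset_cong) (metis assms(2) inf.absorb1)
  then show ?thesis
    by (simp add: sum_vdeg[OF assms(1)])
qed

text \<open>Follow an alternating trail from \<open>i\<close>, deleting each edge used. Its first
  edge lies in \<open>P\<close>; if \<open>P\<close> has no surplus at the other end
  \<open>k\<close>, then without that edge \<open>Q\<close> has one, and the trail continues from
  \<open>k\<close> with the roles of \<open>P\<close> and \<open>Q\<close> exchanged. The two
  alternatives are trails ending in \<open>P\<close> and in \<open>Q\<close>. The term
  \<open>of_bool (i = j)\<close> demands a gap of two when the trail returns to
  \<open>i\<close>.\<close>

lemma alternating_exchange:
  assumes "\<And>e. e \<in># P + Q \<Longrightarrow> card e = 2" and "vdeg Q i < vdeg P i"
  shows "\<exists>P1 Q1 j. P1 \<subseteq># P \<and> Q1 \<subseteq># Q \<and>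
    (size P1 = size Q1 + 1 \<and>
       (\<forall>v. vdeg P1 v = vdeg Q1 v + of_bool (v = i) + of_bool (v = j)) \<and>
       vdeg Q j + of_bool (i = j) < vdeg P j \<or>
     size P1 = size Q1 \<and>
       (\<forall>v. vdeg P1 v + of_bool (v = j) = vdeg Q1 v + of_bool (v = i)) \<and>
       vdeg P j < vdeg Q j + of_bool (i = j))"
  using assms
proof (induction "size P + size Q" arbitrary: P Q i rule: less_induct)
  case less
  have "vdeg P i \<noteq> 0"
    using less.prems(2) by simp
  then obtain e where e: "e \<in># P" "i \<in> e"
    by (auto simp: vdeg_eq_0_iff)
  have "card e = 2"
    using less.prems(1) e by auto
  then obtain k where k: "e = {i, k}" "i \<noteq> k"
    using e(2) by (auto simp: card_2_iff)
  from multi_member_split[OF e(1)] obtain P' where P': "P = add_mset e P'"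
    by blast
  show ?case
  proof (cases "vdeg Q k < vdeg P k")
    case True
    then show ?thesis
      using k e(1) by (intro exI[of _ "{#e#}"] exI[of _ "{#}"] exI[of _ k]) auto
  next
    case False
    then have "vdeg P' k < vdeg Q k"
      by (simp add: P' k)
    moreover have "\<And>e. e \<in># Q + P' \<Longrightarrow> card e = 2"
      using less.prems(1) by (auto simp: P')
    ultimately obtain Q1 P1 j where *: "Q1 \<subseteq># Q" "P1 \<subseteq># P'" and
      "size Q1 = size P1 + 1 \<and>
         (\<forall>v. vdeg Q1 v = vdeg P1 v + of_bool (v = k) + of_bool (v = j)) \<and>
         vdeg P' j + of_bool (k = j) < vdeg Q j \<or>
       size Q1 = size P1 \<and>
         (\<forall>v. vdeg Q1 v + of_bool (v = j) = vdeg P1 v + of_bool (v = k)) \<and>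
         vdeg Q j < vdeg P' j + of_bool (k = j)" (is "?A \<or> ?B")
      using less.hyps[of Q P' k] by (auto simp: P')
    then consider ?A | ?B by blast
    then show ?thesis
    proof cases
      case 1
      \<comment> \<open>The continuation ends in \<open>Q\<close>; prefixing \<open>e\<close>
        balances the sizes, and its contribution at \<open>k\<close> cancels.\<close>
      have "vdeg P j < vdeg Q j + of_bool (i = j)"
        using 1 k by (auto simp: P')
      moreover have "vdeg (add_mset e P1) v + of_bool (v = j) = vdeg Q1 v + of_bool (v = i)" for v
        using 1 k by auto
      ultimately show ?thesis
        by (intro exI[of _ "add_mset e P1"] exI[of _ Q1] exI[of _ j]) (use 1 * in \<open>auto simp: P'\<close>)
    next
      case 2
      have "vdeg Q j + of_bool (i = j) < vdeg P j"
        using 2 k by (auto simp: P')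
      moreover have "vdeg (add_mset e P1) v = vdeg Q1 v + of_bool (v = i) + of_bool (v = j)" for v
      proof -
        have "vdeg Q1 v + of_bool (v = j) = vdeg P1 v + of_bool (v = k)"
          using 2 by blast
        then show ?thesis using k by auto
      qed
      ultimately show ?thesis
        by (intro exI[of _ "add_mset e P1"] exI[of _ Q1] exI[of _ j]) (use 2 * in \<open>auto simp: P'\<close>)
    qed
  qed
qed

text \<open>Swapping the two sides of an alternating trail moves the degrees of \<open>A\<close>
  towards \<open>B\<close> and those of \<open>B\<close> towards \<open>A\<close> simultaneously: a
  two-step exchange axiom of jump systems.\<close>

lemma degree_exchange [consumes 2, case_names up shift]:
  assumes "\<forall>e\<in>#A + B. e \<in> E \<and> card e = 2" and "vdeg A i < vdeg B i"
  obtains (up) A' B' j where "set_mset A' \<subseteq> E" "set_mset B' \<subseteq> E"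
      "size A' = size A + 1" "size B = size B' + 1"
      "\<And>v. vdeg A' v = vdeg A v + of_bool (v = i) + of_bool (v = j)"
      "\<And>v. vdeg B v = vdeg B' v + of_bool (v = i) + of_bool (v = j)"
      "vdeg A j + of_bool (i = j) < vdeg B j"
    | (shift) A' B' j where "set_mset A' \<subseteq> E" "set_mset B' \<subseteq> E"
      "size A' = size A" "size B' = size B"
      "\<And>v. vdeg A' v + of_bool (v = j) = vdeg A v + of_bool (v = i)"
      "\<And>v. vdeg B' v + of_bool (v = i) = vdeg B v + of_bool (v = j)"
      "j \<noteq> i" "vdeg B j < vdeg A j"
proof -
  obtain P Q j where PQ: "P \<subseteq># B" "Q \<subseteq># A" and
    disj: "size P = size Q + 1 \<and>
       (\<forall>v. vdeg P v = vdeg Q v + of_bool (v = i) + of_bool (v = j)) \<and>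
       vdeg A j + of_bool (i = j) < vdeg B j \<or>
     size P = size Q \<and>
       (\<forall>v. vdeg P v + of_bool (v = j) = vdeg Q v + of_bool (v = i)) \<and>
       vdeg B j < vdeg A j + of_bool (i = j)" (is "?A \<or> ?B")
    using alternating_exchange[of B A i] assms by auto
  let ?A' = "A - Q + P" and ?B' = "B - P + Q"
  have sub: "set_mset ?A' \<subseteq> E" "set_mset ?B' \<subseteq> E"
    using assms(1) set_mset_mono[OF PQ(1)] set_mset_mono[OF PQ(2)]
    by (auto dest: in_diffD simp del: subset_mset.add_diff_assoc2)
  obtain A0 B0 where split: "A = A0 + Q" "B = B0 + P"
    using PQ by (metis subset_mset.diff_add)
  have size: "size ?A' + size Q = size A + size P" "size ?B' + size P = size B + size Q"
    by (simp_all add: split)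
  have deg: "vdeg ?A' v + vdeg Q v = vdeg A v + vdeg P v"
      "vdeg ?B' v + vdeg P v = vdeg B v + vdeg Q v" for v
    by (simp_all add: split)
  from disj consider ?A | ?B by blast
  then show thesis
  proof cases
    case 1
    have "vdeg ?A' v = vdeg A v + of_bool (v = i) + of_bool (v = j)"
      "vdeg B v = vdeg ?B' v + of_bool (v = i) + of_bool (v = j)" for v
      using 1 deg[of v] by simp_all
    with 1 sub size show thesis
      by (intro up[of ?A' ?B' j]) auto
  next
    case 2
    have "vdeg ?A' v + of_bool (v = j) = vdeg A v + of_bool (v = i)"
      "vdeg ?B' v + of_bool (v = i) = vdeg B v + of_bool (v = j)" for v
      using 2 deg[of v] by (smt (verit) add.assoc add.commute add_left_cancel)+
    moreover have "j \<noteq> i" 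
      using 2 assms(2) by auto
    ultimately show thesis
      using 2 sub size by (intro shift[of ?A' ?B' j]) auto
  qed
qed


section \<open>Augmenting a maximum packing\<close>

text \<open>In matching terms, \<open>M\<close> is a largest \<open>a\<close>-matching with repeated
  edges allowed. A vertex \<open>v\<close> with \<open>vdeg M v < a v\<close> is called
  exposed.\<close>

locale maximum_packing =
  fixes W :: "'v set" and E :: "'v set set" and a :: "'v \<Rightarrow> nat" and M :: "'v set multiset"
  assumes finite_W: "finite W"
    and edge: "e \<in> E \<Longrightarrow> e \<subseteq> W \<and> card e = 2"
    and M_edges: "set_mset M \<subseteq> E"
    and M_le: "vdeg M v \<le> a v"
    and maximal: "set_mset B \<subseteq> E \<Longrightarrow> (\<And>v. vdeg B v \<le> a v) \<Longrightarrow> size B \<le> size M"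
begin

text \<open>Induction on the l1 distance between the degrees of \<open>B\<close> and
  \<open>M\<close>. An \<open>up\<close> exchange either raises \<open>u\<close> twice, as wanted,
  or contradicts maximality; a \<open>shift\<close> exchange brings \<open>B\<close> closer to
  \<open>M\<close> and keeps its size and its bounds away from \<open>u\<close>.\<close>

lemma augment_at_exposed:
  assumes "vdeg M u < a u" "set_mset B \<subseteq> E" "size M < size B"
    and "\<And>v. v \<noteq> u \<Longrightarrow> vdeg B v \<le> a v"
  shows "\<exists>B'. set_mset B' \<subseteq> E \<and> size B' = size M + 1 \<and>
    (\<forall>v. vdeg B' v = vdeg M v + 2 * of_bool (v = u))"
  using assms(2-4)
proof (induction "\<Sum>v\<in>W. (vdeg B v - vdeg M v) + (vdeg M v - vdeg B v)" arbitrary: B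
    rule: less_induct)
  case less
  have edges: "\<forall>e\<in>#M + B. e \<in> E \<and> card e = 2"
    using M_edges less.prems(1) edge by auto
  have "\<exists>v\<in>W. vdeg M v < vdeg B v"
  proof (rule ccontr)
    assume "\<not> ?thesis"
    then have "(\<Sum>v\<in>W. vdeg B v) \<le> (\<Sum>v\<in>W. vdeg M v)"
      by (meson not_less sum_mono)
    moreover have "(\<Sum>v\<in>W. vdeg B v) = 2 * size B" "(\<Sum>v\<in>W. vdeg M v) = 2 * size M"
      using less.prems(1) M_edges edge by (auto intro!: handshake finite_W)
    ultimately show False
      using less.prems(2) by simp
  qed
  \<comment> \<open>Surplus vertices other than \<open>u\<close> are preferred; \<open>i = u\<close>
    is taken only if there are none, which then forces \<open>j = u\<close>.\<close>
  then obtain i where i: "vdeg M i < vdeg B i"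
    and iu: "i \<noteq> u \<or> (\<forall>v. v \<noteq> u \<longrightarrow> vdeg B v \<le> vdeg M v)"
    by (metis not_less)
  from edges i show ?case
  proof (cases rule: degree_exchange)
    case (up A' B' j)
    show ?thesis
    proof (cases "i = u")
      case True
      then have "j = u"
        using iu up(7) by fastforce
      then have "vdeg A' v = vdeg M v + 2 * of_bool (v = u)" for v
        using up(5)[of v] True by simp
      then show ?thesis
        using up(1,3) by blast
    next
      case False
      \<comment> \<open>At \<open>u\<close> at most one unit is added, which fits since
        \<open>u\<close> is exposed; elsewhere the raised degrees stay below those of
        \<open>B\<close>.\<close>
      have "vdeg A' v \<le> a v" for v
      proof (cases "v = u")
        case True
        then show ?thesis
          using up(5)[of v] False assms(1) by auto
      next
        case False
        then show ?thesis
          using up(5)[of v] up(7) i less.prems(3)[of v] M_le[of v] by (auto split: if_splits)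
      qed
      then have "size A' \<le> size M"
        by (intro maximal up(1))
      then show ?thesis
        using up(3) by simp
    qed
  next
    case (shift A' B' j)
    have "i \<in> W"
    proof -
      have "vdeg B i \<noteq> 0"
        using i by simp
      then show ?thesis
        using less.prems(1) edge by (auto simp: vdeg_eq_0_iff)
    qed
    have B': "vdeg B' v = vdeg B v + of_bool (v = j) - of_bool (v = i)" for v
      using shift(6)[of v] by simp
    have "(\<Sum>v\<in>W. (vdeg B' v - vdeg M v) + (vdeg M v - vdeg B' v))
        < (\<Sum>v\<in>W. (vdeg B v - vdeg M v) + (vdeg M v - vdeg B v))"
    proof (rule sum_strict_mono_ex1[OF finite_W])
      show "\<exists>v\<in>W. (vdeg B' v - vdeg M v) + (vdeg M v - vdeg B' v)
          < (vdeg B v - vdeg M v) + (vdeg M v - vdeg B v)"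
        using i shift(7) by (intro bexI[OF _ \<open>i \<in> W\<close>]) (simp add: B')
      show "\<forall>v\<in>W. (vdeg B' v - vdeg M v) + (vdeg M v - vdeg B' v)
          \<le> (vdeg B v - vdeg M v) + (vdeg M v - vdeg B v)"
        using i shift(7,8) by (auto simp: B')
    qed
    moreover have "vdeg B' v \<le> a v" if "v \<noteq> u" for v
      using less.prems(3)[OF that] shift(8) M_le[of v] by (auto simp: B')
    ultimately show ?thesis
      using shift(2,4) less.prems(2) by (intro less.hyps[of B']) auto
  qed
qed

text \<open>Exchange at a new vertex \<open>u\<close> between the multiset for \<open>S\<close> and
  the one for \<open>u\<close>. A \<open>shift\<close> to \<open>j\<close> would leave
  \<open>size M\<close> + 1 edges of degree \<open>vdeg M\<close> plus one at each of the exposed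
  vertices \<open>u\<close> and \<open>j\<close>, against maximality.\<close>

lemma augment_at_set:
  assumes "finite S" and "\<And>u. u \<in> S \<Longrightarrow> vdeg M u < a u"
    and "\<And>u. u \<in> S \<Longrightarrow> \<exists>B. set_mset B \<subseteq> E \<and> size B = size M + 1 \<and>
      (\<forall>v. vdeg B v = vdeg M v + 2 * of_bool (v = u))"
  shows "\<exists>B. set_mset B \<subseteq> E \<and> size B = size M + card S \<and>
    (\<forall>v. vdeg B v = vdeg M v + 2 * of_bool (v \<in> S))"
  using assms
proof (induction S)
  case empty
  show ?case
    using M_edges by (intro exI[of _ M]) simp
next
  case (insert u S)
  obtain A where A: "set_mset A \<subseteq> E" "size A = size M + card S"
      "\<And>v. vdeg A v = vdeg M v + 2 * of_bool (v \<in> S)"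
    using insert by blast
  obtain B where B: "set_mset B \<subseteq> E" "size B = size M + 1"
      "\<And>v. vdeg B v = vdeg M v + 2 * of_bool (v = u)"
    using insert.prems(2) by blast
  have edges: "\<forall>e\<in>#A + B. e \<in> E \<and> card e = 2"
    using A(1) B(1) edge by auto
  have lt: "vdeg A u < vdeg B u"
    using insert.hyps(2) by (simp add: A(3) B(3))
  from edges lt show ?case
  proof (cases rule: degree_exchange)
    case (up A' B' j)
    \<comment> \<open>Only at \<open>u\<close> does \<open>B\<close> have larger degree than
      \<open>A\<close>.\<close>
    have "j = u"
      using up(7) by (cases "j = u") (auto simp: A(3) B(3))
    then have "vdeg A' v = vdeg M v + 2 * of_bool (v \<in> insert u S)" for v
      using up(5)[of v] insert.hyps(2) by (auto simp: A(3))
    moreover have "size A' = size M + card (insert u S)"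
      using up(3) A(2) insert.hyps by simp
    ultimately show ?thesis
      using up(1) by blast
  next
    case (shift A' B' j)
    have "j \<in> S"
      using shift(7,8) by (auto simp: A(3) B(3) split: if_splits)
    have "vdeg B' v = vdeg M v + of_bool (v = u) + of_bool (v = j)" for v
      using shift(6)[of v] by (auto simp: B(3))
    moreover have "vdeg M u < a u" "vdeg M j < a j"
      using insert.prems(1) \<open>j \<in> S\<close> by auto
    ultimately have "vdeg B' v \<le> a v" for v
      using shift(7) M_le[of v] by auto
    then have "size B' \<le> size M"
      by (intro maximal shift(2))
    then show ?thesis
      using shift(4) B(2) by simp
  qed
qed

text \<open>An edge with both ends exposed could be added to \<open>M\<close>.\<close>

lemma exposed_independent:
  assumes "e \<in> E"
  shows "card (e \<inter> {v \<in> W. vdeg M v < a v}) \<le> 1"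
proof (rule ccontr)
  let ?U = "{v \<in> W. vdeg M v < a v}"
  assume "\<not> ?thesis"
  moreover have "finite e" "card e = 2"
    using edge[OF assms] by (auto intro: card_ge_0_finite)
  ultimately have "e \<inter> ?U = e"
    by (intro card_seteq) auto
  then have "vdeg M v < a v" if "v \<in> e" for v
    using that by blast
  then have "vdeg (add_mset e M) v \<le> a v" for v
    using M_le[of v] by (cases "v \<in> e") (auto simp: Suc_le_eq)
  then have "size (add_mset e M) \<le> size M"
    using assms M_edges by (intro maximal) auto
  then show False by simp
qed

text \<open>The blowup will provide \<open>defect\<close>, and membership in the saturation will
  provide \<open>augmentable\<close>.\<close>

lemma sum_capacity_le:
  assumes defect: "\<And>v. v \<in> W \<Longrightarrow> a v \<le> vdeg M v + 1"
    and augmentable: "\<And>u. u \<in> W \<Longrightarrow> vdeg M u < a u \<Longrightarrow>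
      \<exists>B. set_mset B \<subseteq> E \<and> size M < size B \<and> (\<forall>v. v \<noteq> u \<longrightarrow> vdeg B v \<le> a v)"
  shows "(\<Sum>v\<in>W. a v) \<le> 3 * size M"
proof -
  define U where "U = {v \<in> W. vdeg M v < a v}"
  have U: "finite U" "U \<subseteq> W"
    by (auto simp: U_def finite_W)
  have "\<exists>B. set_mset B \<subseteq> E \<and> size B = size M + 1 \<and>
      (\<forall>v. vdeg B v = vdeg M v + 2 * of_bool (v = u))" if "u \<in> U" for u
    using that augmentable[of u] augment_at_exposed[of u] unfolding U_def by blast
  then obtain B where B: "set_mset B \<subseteq> E" "size B = size M + card U"
      "\<And>v. vdeg B v = vdeg M v + 2 * of_bool (v \<in> U)"
    using augment_at_set[OF U(1)] unfolding U_def by blast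
  \<comment> \<open>Double counting of the degrees on \<open>U\<close>: at least two per vertex, at
    most one per edge of \<open>B\<close>.\<close>
  have "2 * card U = (\<Sum>v\<in>U. 2)"
    by simp
  also have "\<dots> \<le> (\<Sum>v\<in>U. vdeg B v)"
    by (intro sum_mono) (simp add: B(3))
  also have "\<dots> = (\<Sum>e\<in>#B. card (e \<inter> U))"
    by (rule sum_vdeg[OF U(1)])
  also have "\<dots> \<le> (\<Sum>e\<in>#B. 1)"
    using B(1) exposed_independent by (intro sum_mset_mono) (auto simp: U_def)
  also have "\<dots> = size M + card U"
    by (simp add: B(2))
  finally have "card U \<le> size M"
    by simp
  \<comment> \<open>By \<open>defect\<close>, each exposed vertex misses exactly one unit.\<close>
  have "a v = vdeg M v + of_bool (v \<in> U)" if "v \<in> W" for v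
    using that defect[OF that] M_le[of v] by (auto simp: U_def)
  then have "(\<Sum>v\<in>W. a v) = (\<Sum>v\<in>W. vdeg M v) + (\<Sum>v\<in>W. of_bool (v \<in> U))"
    by (simp add: sum.distrib)
  also have "(\<Sum>v\<in>W. vdeg M v) = 2 * size M"
    using M_edges edge by (auto intro!: handshake finite_W)
  also have "(\<Sum>v\<in>W. of_bool (v \<in> U)) = card U"
    using U by (simp add: of_bool_def sum.If_cases finite_W Int_absorb1)
  finally show ?thesis
    using \<open>card U \<le> size M\<close> by simp
qed

end

section \<open>Blowing up vertices\<close>

text \<open>All vertices get the same number of copies; a 0/1 capacity function selects the usable
  ones later, so the graph does not depend on the exponents.\<close>

definition blowup :: "'v set set \<Rightarrow> nat \<Rightarrow> ('v \<times> nat) set set" where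
  "blowup E K = {{(i, k), (j, l)} | i j k l. {i, j} \<in> E \<and> k < K \<and> l < K}"

context
  fixes E :: "'v set set" and K :: nat
  assumes edge2: "e \<in> E \<Longrightarrow> card e = 2"
begin

lemma edgeE:
  assumes "e \<in> E"
  obtains i j where "e = {i, j}" "i \<noteq> j"
  using edge2[OF assms] by (auto simp: card_2_iff)

lemma blowupE:
  assumes "e \<in> blowup E K"
  obtains i j k l where "e = {(i, k), (j, l)}" "{i, j} \<in> E" "i \<noteq> j" "k < K" "l < K"
proof -
  obtain i j k l where *: "e = {(i, k), (j, l)}" "{i, j} \<in> E" "k < K" "l < K"
    using assms by (auto simp: blowup_def)
  moreover have "i \<noteq> j"
    using edge2[OF *(2)] by auto
  ultimately show thesis
    using that by blast
qed

lemma blowup_edge: "e \<in> blowup E K \<Longrightarrow> e \<subseteq> UNIV \<times> {..<K} \<and> card e = 2"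
  by (erule blowupE) auto

lemma sum_fibre_of_bool:
  assumes "i \<noteq> j" "k < K" "l < K"
  shows "(\<Sum>x<K. of_bool ((v, x) \<in> {(i, k), (j, l)})) = (of_bool (v \<in> {i, j}) :: nat)"
proof -
  have "(\<Sum>x<K. of_bool ((v, x) \<in> {(i, k), (j, l)}) :: nat)
      = (\<Sum>x<K. if x = k then of_bool (v = i) else 0) + (\<Sum>x<K. if x = l then of_bool (v = j) else 0)"
    using assms(1) by (subst sum.distrib[symmetric]) (auto intro!: sum.cong)
  then show ?thesis
    using assms by (simp add: sum.delta)
qed

text \<open>An edge of the blowup meets each fibre at most once, so forgetting the copy index adds
  up the degrees along fibres.\<close>

lemma blowup_project:
  assumes "set_mset B \<subseteq> blowup E K"
  shows "set_mset (image_mset ((`) fst) B) \<subseteq> E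
    \<and> vdeg (image_mset ((`) fst) B) v = (\<Sum>k<K. vdeg B (v, k))"
  using assms
proof (induction B)
  case (add e B)
  then have "e \<in> blowup E K" by simp
  then obtain i j k l where e: "e = {(i, k), (j, l)}" "{i, j} \<in> E" "i \<noteq> j" "k < K" "l < K"
    by (rule blowupE)
  show ?case
    using add e(2) sum_fibre_of_bool[OF e(3-5), of v] by (simp add: sum.distrib e(1))
qed simp

text \<open>Greedy lifting: positive fibre sums give a copy with spare capacity at each end of an
  edge. The induction varies \<open>c\<close>, so that the used units can be subtracted.\<close>

lemma blowup_lift:
  assumes "set_mset B \<subseteq> E" and "\<And>v. vdeg B v \<le> (\<Sum>k<K. c (v, k))"
  shows "\<exists>B'. set_mset B' \<subseteq> blowup E K \<and> size B' = size B \<and> (\<forall>x. vdeg B' x \<le> c x)"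
  using assms
proof (induction B arbitrary: c)
  case empty
  show ?case
    by (intro exI[of _ "{#}"]) simp
next
  case (add e B)
  obtain i j where e: "e = {i, j}" "i \<noteq> j"
    using add.prems(1) by (auto elim: edgeE)
  have "(\<Sum>k<K. c (i, k)) \<noteq> 0" "(\<Sum>k<K. c (j, k)) \<noteq> 0"
    using add.prems(2)[of i] add.prems(2)[of j] by (auto simp: e simp del: sum_eq_0_iff)
  then obtain k l where kl: "k < K" "c (i, k) \<noteq> 0" "l < K" "c (j, l) \<noteq> 0"
    by (metis (no_types, lifting) lessThan_iff sum.neutral)
  let ?e = "{(i, k), (j, l)}"
  define c' where "c' x = c x - of_bool (x \<in> ?e)" for x
  have c: "c x = c' x + of_bool (x \<in> ?e)" for x
    using kl by (auto simp: c'_def)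
  have "vdeg B v \<le> (\<Sum>k<K. c' (v, k))" for v
    using add.prems(2)[of v] sum_fibre_of_bool[OF e(2) kl(1,3), of v]
    by (simp only: c sum.distrib vdeg_add_mset e(1))
  then obtain B' where B': "set_mset B' \<subseteq> blowup E K" "size B' = size B" "\<And>x. vdeg B' x \<le> c' x"
    using add.IH[of c'] add.prems(1) by auto
  have "?e \<in> blowup E K"
    using add.prems(1) e kl by (auto simp: blowup_def)
  then show ?case
    using B' by (intro exI[of _ "add_mset ?e B'"]) (auto simp: c simp del: insert_iff)
qed

end

section \<open>Packings of prescribed size and the bound on the total capacity\<close>

lemma submultiset_of_size:
  assumes "t \<le> size B"
  obtains C where "C \<subseteq># B" "size C = t"
proof -
  obtain xs where xs: "mset xs = B"
    using ex_mset by blast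
  have "mset (take t xs) \<subseteq># B"
    using append_take_drop_id[of t xs] xs by (metis mset_append mset_subset_eq_add_left)
  moreover have "size (mset (take t xs)) = t"
    using assms xs by auto
  ultimately show thesis
    by (rule that)
qed

text \<open>For two-element edges this is the combinatorial form of membership of the monomial in
  the \<open>t\<close>-th power of the edge ideal.\<close>

definition packs :: "'v set set \<Rightarrow> nat \<Rightarrow> ('v \<Rightarrow> nat) \<Rightarrow> bool" where
  "packs E t a \<longleftrightarrow> (\<exists>B. set_mset B \<subseteq> E \<and> size B = t \<and> (\<forall>v. vdeg B v \<le> a v))"

lemma sum_capacity_le_of_packs:
  fixes E :: "'n::finite set set"
  assumes edge2: "\<And>e. e \<in> E \<Longrightarrow> card e = 2"
    and not_packs: "\<not> packs E t a"
    and packs: "\<And>i. packs E t (\<lambda>v. a v + m * of_bool (v = i))"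
  shows "(\<Sum>i\<in>UNIV. a i) \<le> 3 * (t - 1)"
proof -
  \<comment> \<open>Any common bound for the \<open>a i\<close> would do: each fibre must contain
    \<open>a i\<close> usable copies.\<close>
  define K where "K = (\<Sum>i\<in>UNIV. a i)"
  have a_le: "a i \<le> K" for i
    unfolding K_def by (rule member_le_sum) auto
  define W :: "('n \<times> nat) set" where "W = UNIV \<times> {..<K}"
  define c :: "'n \<times> nat \<Rightarrow> nat" where "c x = of_bool (snd x < a (fst x))" for x
  have sum_c: "(\<Sum>k<K. c (i, k)) = a i" for i
  proof -
    have "{..<K} \<inter> {k. k < a i} = {..<a i}"
      using a_le[of i] by auto
    then show ?thesis
      by (simp add: c_def of_bool_def sum.If_cases)
  qed
  define F where "F = {B. set_mset B \<subseteq> blowup E K \<and> (\<forall>x. vdeg B x \<le> c x)}"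
  have size_F: "size B < t" if "B \<in> F" for B
  proof (rule ccontr)
    \<comment> \<open>Trimmed to exactly \<open>t\<close> edges, \<open>B\<close> would project to a
      packing below \<open>a\<close>.\<close>
    assume "\<not> size B < t"
    then obtain C where C: "C \<subseteq># B" "size C = t"
      by (meson not_less submultiset_of_size)
    have C_edges: "set_mset C \<subseteq> blowup E K"
      using that set_mset_mono[OF C(1)] by (auto simp: F_def)
    have "vdeg C x \<le> c x" for x
      using that vdeg_diff[OF C(1), of x] unfolding F_def
      by (metis (mono_tags, lifting) le_add2 mem_Collect_eq order_trans)
    then have "(\<Sum>k<K. vdeg C (v, k)) \<le> a v" for v
      by (simp add: sum_mono flip: sum_c)
    then have "packs E t a"
      unfolding packs_def using blowup_project[OF edge2 C_edges] C(2)
      by (intro exI[of _ "image_mset ((`) fst) C"]) auto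
    with not_packs show False ..
  qed
  have "{#} \<in> F"
    by (simp add: F_def)
  then obtain M where M: "M \<in> F" "\<And>B. B \<in> F \<Longrightarrow> size B \<le> size M"
    using ex_has_greatest_nat[of "\<lambda>B. B \<in> F" "{#}" size t] size_F by (metis less_imp_le)
  interpret maximum_packing W "blowup E K" c M
    using M blowup_edge[OF edge2] by unfold_locales (auto simp: W_def F_def)
  have "(\<Sum>x\<in>W. c x) \<le> 3 * size M"
  proof (rule sum_capacity_le)
    show "c x \<le> vdeg M x + 1" for x
      by (simp add: c_def)
    show "\<exists>B. set_mset B \<subseteq> blowup E K \<and> size M < size B \<and> (\<forall>x. x \<noteq> u \<longrightarrow> vdeg B x \<le> c x)"
      if "u \<in> W" for u
    proof -
      obtain i l where u: "u = (i, l)" "l < K"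
        using \<open>u \<in> W\<close> by (cases u) (auto simp: W_def)
      obtain B where B: "set_mset B \<subseteq> E" "size B = t" "\<And>v. vdeg B v \<le> a v + m * of_bool (v = i)"
        using packs[of i] by (auto simp: packs_def)
      \<comment> \<open>All \<open>m\<close> extra units go to the single copy \<open>u\<close>, so
        the lift can exceed \<open>c\<close> only there.\<close>
      define d where "d x = c x + (if x = u then m else 0)" for x
      have "(\<Sum>k<K. d (v, k)) = a v + (\<Sum>k<K. if k = l then m * of_bool (v = i) else 0)" for v
        unfolding d_def sum.distrib sum_c by (auto simp: u intro!: sum.cong)
      then have "(\<Sum>k<K. d (v, k)) = a v + m * of_bool (v = i)" for v
        using u(2) by simp
      then obtain B' where B': "set_mset B' \<subseteq> blowup E K" "size B' = t" "\<And>x. vdeg B' x \<le> d x"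
        using blowup_lift[OF edge2 B(1), where K = K and c = d] B(2,3) by auto
      have "vdeg B' x \<le> c x" if "x \<noteq> u" for x
        using B'(3)[of x] that by (simp add: d_def)
      then show ?thesis
        using B' size_F[OF M(1)] by (intro exI[of _ B']) auto
    qed
  qed
  also have "(\<Sum>x\<in>W. c x) = (\<Sum>i\<in>UNIV. \<Sum>k<K. c (i, k))"
    unfolding W_def by (simp add: sum.cartesian_product)
  \<comment> \<open>The strict bound \<open>size M < t\<close> gives \<open>t - 1\<close> without
    truncation.\<close>
  finally show ?thesis
    using size_F[OF M(1)] by (simp add: sum_c)
qed

section \<open>Monomials in powers of the edge ideal\<close>

lemma mpoly_ring_simps [simp]:
  "carrier mpoly_ring = UNIV"
  "x \<otimes>\<^bsub>mpoly_ring\<^esub> y = x * y"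
  "x \<oplus>\<^bsub>mpoly_ring\<^esub> y = x + y"
  "\<zero>\<^bsub>mpoly_ring\<^esub> = 0"
  by (simp_all add: ring_of_type_algebra_def)

lemma ideals_set_simps [simp]:
  "I \<otimes>\<^bsub>ideals_set R\<^esub> J = I \<cdot>\<^bsub>R\<^esub> J"
  "\<one>\<^bsub>ideals_set R\<^esub> = carrier R"
  by (simp_all add: ideals_set_def)

lemma monomial_eq_single:
  "monomial a = (Poly_Mapping.single (\<Sum>i\<in>UNIV. Poly_Mapping.single i (a i)) 1 :: ('n::finite, 'k::field) mpoly)"
proof -
  have pow: "(Var i :: ('n, 'k) mpoly) ^ n = Poly_Mapping.single (Poly_Mapping.single i n) 1" for i n
    by (induction n) (simp_all add: Var_def mult_single single_add[symmetric])
  have "finite S \<Longrightarrow> (\<Prod>i\<in>S. (Var i :: ('n, 'k) mpoly) ^ a i)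
      = Poly_Mapping.single (\<Sum>i\<in>S. Poly_Mapping.single i (a i)) 1" for S
    by (induction S rule: finite_induct) (simp_all add: pow mult_single)
  then show ?thesis
    by (simp add: monomial_def)
qed

lemma lookup_sum_single:
  "Poly_Mapping.lookup (\<Sum>i\<in>UNIV. Poly_Mapping.single i (a i)) = (a :: 'n::finite \<Rightarrow> nat)"
  by (rule ext) (simp add: lookup_sum lookup_single when_def)

lemma keys_monomial:
  "Poly_Mapping.keys (monomial a :: ('n::finite, 'k::field) mpoly) = {\<Sum>i\<in>UNIV. Poly_Mapping.single i (a i)}"
  by (simp add: monomial_eq_single)

lemma monomial_add:
  "monomial (\<lambda>v. a v + b v) = (monomial a * monomial b :: ('n::finite, 'k::field) mpoly)"
  by (simp add: monomial_def power_add prod.distrib)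

lemma Var_power_eq_monomial:
  "Var i ^ m = (monomial (\<lambda>v. m * of_bool (v = i)) :: ('n::finite, 'k::field) mpoly)"
proof -
  have "(monomial (\<lambda>v. m * of_bool (v = i)) :: ('n, 'k) mpoly)
      = (\<Prod>v\<in>UNIV. if v = i then Var v ^ m else 1)"
    unfolding monomial_def by (intro prod.cong) auto
  then show ?thesis
    by simp
qed

text \<open>Powers of single variables are the test elements with which the saturation is
  exploited.\<close>

lemma Var_power_in_irrelevant_power:
  "Var i ^ m \<in> ideal_power mpoly_ring (irrelevant_ideal :: ('n, 'k::field) mpoly set) m"
proof (induction m)
  case (Suc m)
  interpret ring "mpoly_ring :: ('n, 'k) mpoly ring"
    by (rule ring_from_type_algebra)
  have "Var i \<in> (irrelevant_ideal :: ('n, 'k) mpoly set)"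
    unfolding irrelevant_ideal_def using genideal_self[of "range Var"] by auto
  from ideal_prod.prod[OF Suc this, of mpoly_ring] show ?case
    by (simp add: power_commutes)
qed simp

text \<open>The span of the monomials with packable exponents: an ideal that will contain the
  \<open>t\<close>-th power of the edge ideal, with membership visible from
  \<open>keys\<close>.\<close>

definition packed_polys :: "'n set set \<Rightarrow> nat \<Rightarrow> ('n, 'k::field) mpoly set" where
  "packed_polys E t = {f. \<forall>m\<in>Poly_Mapping.keys f. packs E t (Poly_Mapping.lookup m)}"

lemma packs_add:
  assumes "packs E s a" "packs E t b"
  shows "packs E (s + t) (\<lambda>v. a v + b v)"
proof -
  obtain A B where "set_mset A \<subseteq> E" "size A = s" "\<And>v. vdeg A v \<le> a v"
    "set_mset B \<subseteq> E" "size B = t" "\<And>v. vdeg B v \<le> b v"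
    using assms by (auto simp: packs_def)
  then show ?thesis
    unfolding packs_def by (intro exI[of _ "A + B"]) (auto intro: add_mono)
qed

lemma packed_polys_add:
  "f \<in> packed_polys E t \<Longrightarrow> g \<in> packed_polys E t \<Longrightarrow> f + g \<in> packed_polys E t"
  using keys_add[of f g] by (auto simp: packed_polys_def)

lemma packed_polys_mult:
  assumes "f \<in> packed_polys E s" "g \<in> packed_polys E t"
  shows "f * g \<in> packed_polys E (s + t)"
  using keys_mult[of f g] assms packs_add
  by (fastforce simp: packed_polys_def lookup_add plus_poly_mapping.rep_eq)

lemma packed_polys_0: "packed_polys E 0 = UNIV"
  by (auto simp: packed_polys_def packs_def)

lemma ideal_packed_polys: "ideal (packed_polys E t :: ('n, 'k::field) mpoly set) mpoly_ring"
proof -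
  interpret ring "mpoly_ring :: ('n, 'k) mpoly ring"
    by (rule ring_from_type_algebra)
  have mult: "f * g \<in> packed_polys E t" "g * f \<in> packed_polys E t"
    if "f \<in> packed_polys E t" for f g :: "('n, 'k) mpoly"
    using packed_polys_mult[OF that, of g 0] by (simp_all add: packed_polys_0 mult.commute)
  show ?thesis
  proof (rule idealI[OF ring_axioms])
    show "subgroup (packed_polys E t) (add_monoid (mpoly_ring :: ('n, 'k) mpoly ring))"
    proof (rule add.subgroupI)
      show "(packed_polys E t :: ('n, 'k) mpoly set) \<noteq> {}"
        by (auto simp: packed_polys_def intro!: exI[of _ 0])
      show "\<ominus>\<^bsub>mpoly_ring\<^esub> f \<in> packed_polys E t" if "f \<in> packed_polys E t" for f :: "('n, 'k) mpoly"
      proof -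
        have "\<ominus>\<^bsub>mpoly_ring\<^esub> f = f * (- 1)"
          by (rule minus_equality) simp_all
        then show ?thesis
          using mult(1)[OF that, of "- 1"] by (simp only:)
      qed
    qed (auto intro: packed_polys_add)
  qed (auto intro: mult)
qed

lemma edge_ideal_subset:
  assumes edge2: "\<And>e. e \<in> E \<Longrightarrow> card e = 2"
  shows "edge_ideal E \<subseteq> (packed_polys E 1 :: ('n, 'k::field) mpoly set)"
proof -
  interpret ring "mpoly_ring :: ('n, 'k) mpoly ring"
    by (rule ring_from_type_algebra)
  have "Var i * Var j \<in> (packed_polys E 1 :: ('n, 'k) mpoly set)" if "{i, j} \<in> E" for i j
  proof -
    have "i \<noteq> j"
      using edge2[OF that] by auto
    then show ?thesis
      using that unfolding packed_polys_def packs_def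
      by (auto simp: Var_def mult_single lookup_add lookup_single when_def intro!: exI[of _ "{#{i, j}#}"])
  qed
  then show ?thesis
    unfolding edge_ideal_def by (intro genideal_minimal ideal_packed_polys) auto
qed

lemma edge_ideal_power_subset:
  assumes edge2: "\<And>e. e \<in> E \<Longrightarrow> card e = 2"
  shows "ideal_power mpoly_ring (edge_ideal E) t \<subseteq> (packed_polys E t :: ('n, 'k::field) mpoly set)"
proof (induction t)
  case (Suc t)
  show ?case
  proof
    fix f :: "('n, 'k) mpoly"
    assume "f \<in> ideal_power mpoly_ring (edge_ideal E) (Suc t)"
    then have "f \<in> ideal_power mpoly_ring (edge_ideal E) t \<cdot>\<^bsub>mpoly_ring\<^esub> edge_ideal E"
      by simp
    then show "f \<in> packed_polys E (Suc t)"
    proof induction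
      case (prod f g)
      then have "f * g \<in> packed_polys E (t + 1)"
        using Suc edge_ideal_subset[OF edge2] by (intro packed_polys_mult) auto
      then show ?case by simp
    qed (simp add: packed_polys_add)
  qed
qed (simp add: packed_polys_0)

text \<open>Split one edge \<open>{i, j}\<close> off the packing: the monomial factors as
  \<open>Var i * Var j\<close> times one whose exponent \<open>a'\<close> still packs the remaining
  edges.\<close>

lemma monomial_in_edge_ideal_power:
  fixes E :: "'n::finite set set"
  assumes edge2: "\<And>e. e \<in> E \<Longrightarrow> card e = 2" and "packs E t a"
  shows "monomial a \<in> ideal_power mpoly_ring (edge_ideal E :: ('n, 'k::field) mpoly set) t"
  using assms(2)
proof (induction t arbitrary: a)
  case (Suc t)
  interpret ring "mpoly_ring :: ('n, 'k) mpoly ring"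
    by (rule ring_from_type_algebra)
  obtain B where B: "set_mset B \<subseteq> E" "size B = Suc t" "\<And>v. vdeg B v \<le> a v"
    using Suc.prems by (auto simp: packs_def)
  obtain e B' where B': "B = add_mset e B'"
    using B(2) by (auto dest: size_eq_Suc_imp_eq_union)
  obtain i j where e: "e = {i, j}" "i \<noteq> j"
    using edge2[of e] B(1) by (auto simp: B' card_2_iff)
  define a' where "a' v = a v - of_bool (v \<in> e)" for v
  have "vdeg B' v \<le> a' v" for v
    using B(3)[of v] by (simp add: B' a'_def)
  then have "packs E t a'"
    using B(1,2) unfolding packs_def B' by auto
  \<comment> \<open>The factors 1 match \<open>Var_power_eq_monomial\<close> at exponent 1.\<close>
  have a: "a = (\<lambda>v. a' v + (1 * of_bool (v = i) + 1 * of_bool (v = j)))"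
  proof
    show "a v = a' v + (1 * of_bool (v = i) + 1 * of_bool (v = j))" for v
      using B(3)[of v] e by (auto simp: B' a'_def)
  qed
  have "monomial a = (monomial a' * (Var i ^ 1 * Var j ^ 1) :: ('n, 'k) mpoly)"
    by (subst a) (simp only: monomial_add Var_power_eq_monomial)
  moreover have "Var i * Var j \<in> (edge_ideal E :: ('n, 'k) mpoly set)"
    using B(1) genideal_self[of "{Var i * Var j | i j. {i, j} \<in> E}"]
    unfolding edge_ideal_def B' e by auto
  ultimately show ?case
    using ideal_prod.prod[OF Suc.IH[OF \<open>packs E t a'\<close>], of _ _ mpoly_ring] by simp
qed simp

theorem corollary2p7:
  fixes E :: "'n::finite set set"
    and I :: "('n, 'k::field) mpoly set"
    and t :: nat
    and a :: "'n \<Rightarrow> nat"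
  assumes "simple_graph (UNIV :: 'n set) E"
    and "I = edge_ideal E"
    and "t \<ge> 1"
    and "monomial a \<in> saturation (ideal_power mpoly_ring I t) - ideal_power mpoly_ring I t"
  shows "(\<Sum>i\<in>UNIV. a i) \<le> 3 * (t - 1)"
proof -
  have edge2: "card e = 2" if "e \<in> E" for e
    using assms(1) that by (auto simp: simple_graph_def)
  \<comment> \<open>One exponent \<open>m\<close> serves all variables at once.\<close>
  obtain m where m: "\<And>g. g \<in> ideal_power mpoly_ring irrelevant_ideal m \<Longrightarrow>
      monomial a * g \<in> ideal_power mpoly_ring I t"
    using assms(4) by (auto simp: saturation_def ideal_colon_def)
  show ?thesis
  proof (rule sum_capacity_le_of_packs[OF edge2])
    show "\<not> packs E t a"
      using assms(2,4) monomial_in_edge_ideal_power[OF edge2] by auto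
    show "packs E t (\<lambda>v. a v + m * of_bool (v = i))" for i
    proof -
      \<comment> \<open>The product is again a monomial, with only coordinate \<open>i\<close>
        raised, by \<open>m\<close>; its sole key must therefore be packable.\<close>
      have "monomial a * Var i ^ m \<in> (packed_polys E t :: ('n, 'k) mpoly set)"
        using m[OF Var_power_in_irrelevant_power] edge_ideal_power_subset[OF edge2] assms(2) by blast
      then show ?thesis
        by (simp add: Var_power_eq_monomial packed_polys_def keys_monomial lookup_sum_single
            flip: monomial_add)
    qed
  qed
qed

end
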